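(* Let $f \in \mathbb{Q}^m \setminus \mathbb{Z}^m$ and $R \in \mathbb{Q}^{m \times n}$, and let \[ P_I = \{(x,s) \in \mathbb{Z}^m \times \mathbb{R}^n_+ : x = f + Rs\}, \qquad P = \{(x,s) \in \mathbb{R}^m \times \mathbb{R}^n_+ : x = f + Rs\}, \] where $P_I$ is assumed nonempty. Let $\alpha \in \mathbb{R}^n$ be such that $\alpha^T s \ge 1$ is a valid inequality for $\operatorname{conv}(P_I)$. Then its depth satisfies \[ \operatorname{depth}_P(\alpha, 1) \le \min_j \left\{ \frac{1}{\alpha_j}\sqrt{\Big(\sum_i R_{ij}^2\Big) + 1} \; : \; \alpha_j > 0 \right\}. \]
   Context: $\|\cdot\|$ is the Euclidean norm, and $B(z,r)$ is the closed Euclidean ball of radius $r \ge 0$ centered at $z$. For $P \subseteq \mathbb{R}^N$ and $z \in P$, $\operatorname{depth}_P(z) := \sup\{ r \in \mathbb{R}_+ : B(z,r) \cap \operatorname{aff}(P) \subseteq P\}$, where $\operatorname{aff}(P)$ is the affine hull of $P$. For $S \subseteq P$, $\operatorname{depth}_P(S) := \sup\{\operatorname{depth}_P(z) : z \in P \setminus S\}$, with suprema taken in $[0,+\infty]$ (the supremum of the empty set is $0$). Here the ambient space is $\mathbb{R}^{m+n}$ with points $z = (x,s)$, and the depth of the inequality $\alpha^T s \ge 1$ is $\operatorname{depth}_P(\alpha,1) := \operatorname{depth}_P(\{(x,s) \in P : \alpha^T s \ge 1\})$. *)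

theory Defs
  imports "HOL-Analysis.Analysis"
begin

text \<open>Suprema are taken in \<^typ>\<open>ennreal\<close>, i.e. in $[0,+\infty]$, so the supremum of the
  empty set is 0 and the depth may be infinite.\<close>

definition point_depth :: "'a::euclidean_space set \<Rightarrow> 'a \<Rightarrow> ennreal" where
  "point_depth P z = (SUP r\<in>{r. 0 \<le> r \<and> cball z r \<inter> affine hull P \<subseteq> P}. ennreal r)"

definition set_depth :: "'a::euclidean_space set \<Rightarrow> 'a set \<Rightarrow> ennreal" where
  "set_depth P S = (SUP z\<in>P - S. point_depth P z)"

text \<open>The ambient space of dimension $m+n$ is the product type, whose norm is the Euclidean
  norm \<^term>\<open>sqrt ((norm x)\<^sup>2 + (norm s)\<^sup>2)\<close> of the concatenated vector.\<close>

definition corner_lp :: "real^'m \<Rightarrow> real^'n^'m \<Rightarrow> ((real^'m) \<times> (real^'n)) set" where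
  "corner_lp f R = {(x, s). (\<forall>j. 0 \<le> s $ j) \<and> x = f + R *v s}"

definition corner_mip :: "real^'m \<Rightarrow> real^'n^'m \<Rightarrow> ((real^'m) \<times> (real^'n)) set" where
  "corner_mip f R = {(x, s). (\<forall>i. x $ i \<in> \<int>) \<and> (\<forall>j. 0 \<le> s $ j) \<and> x = f + R *v s}"

definition valid_ineq :: "((real^'m) \<times> (real^'n)) set \<Rightarrow> real^'n \<Rightarrow> real \<Rightarrow> bool" where
  "valid_ineq Q \<alpha> \<beta> \<longleftrightarrow> (\<forall>(x, s)\<in>Q. \<alpha> \<bullet> s \<ge> \<beta>)"

definition ineq_depth :: "((real^'m) \<times> (real^'n)) set \<Rightarrow> real^'n \<Rightarrow> real \<Rightarrow> ennreal" where
  "ineq_depth P \<alpha> \<beta> = set_depth P {(x, s). (x, s) \<in> P \<and> \<alpha> \<bullet> s \<ge> \<beta>}"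

end

theory Submission
  imports Defs
begin

text \<open>Rationality of \<^term>\<open>R\<close> makes every ray \<open>(R\<^sub>j, e\<^sub>j)\<close> a recession direction of the mixed-integer
  hull, so validity forces \<open>\<alpha> \<ge> 0\<close>. A point of the relaxation with \<open>\<alpha> \<bullet> s < 1\<close> then has
  \<open>s\<^sub>j < 1 / \<alpha>\<^sub>j\<close> whenever \<open>\<alpha>\<^sub>j > 0\<close>, and walking along \<open>-(R\<^sub>j, e\<^sub>j)\<close> leaves the relaxation after
  distance \<open>s\<^sub>j \<parallel>(R\<^sub>j, e\<^sub>j)\<parallel>\<close>.\<close>

text \<open>Applied to a column of \<open>R\<close>, this yields a step length along the ray that
  preserves integrality of \<open>x\<close>. The induction multiplies \<open>D\<close> by the
  denominator of the new element.\<close>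

lemma common_denominator_Rats:
  fixes q :: "'i \<Rightarrow> real"
  assumes "finite A" "\<forall>i\<in>A. q i \<in> \<rat>"
  shows "\<exists>D::nat. 0 < D \<and> (\<forall>i\<in>A. real D * q i \<in> \<int>)"
  using assms
proof (induction A)
  case empty
  show ?case by (intro exI[of _ 1]) simp
next
  case (insert a A)
  then obtain D :: nat where D: "0 < D" "\<And>i. i \<in> A \<Longrightarrow> real D * q i \<in> \<int>"
    by auto
  obtain k b where kb: "(b::int) > 0" "q a = of_int k / of_int b"
    using insert.prems by (metis Rats_cases' insertI1)
  have b: "real (nat b) = of_int b" using kb(1) by simp
  have "real (D * nat b) * q i \<in> \<int>" if "i \<in> insert a A" for i
  proof (cases "i = a")
    case True
    have "real (D * nat b) * q a = of_int (int D * k)"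
      using kb by (simp add: b)
    then show ?thesis using True by (metis Ints_of_int)
  next
    case False
    have "real (D * nat b) * q i = of_int b * (real D * q i)"
      by (simp add: b)
    then show ?thesis using D(2) that False by (metis Ints_mult Ints_of_int insertE)
  qed
  then show ?case using D(1) kb(1) by (intro exI[of _ "D * nat b"]) auto
qed

lemma axis_one_nonneg: "0 \<le> axis j (1::real) $ k"
  by (simp add: axis_def)

lemma corner_mip_add_ray:
  assumes "(x, s) \<in> corner_mip f R" "0 \<le> t" "\<And>i. t * R $ i $ j \<in> \<int>"
  shows "(x + t *\<^sub>R column j R, s + t *\<^sub>R axis j 1) \<in> corner_mip f R"
  using assms
  by (auto simp: corner_mip_def matrix_vector_right_distrib matrix_vector_mult_scaleR
      matrix_vector_mult_basis axis_one_nonneg)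
    (simp add: column_def)

text \<open>From a feasible point, steps of size \<open>k * D\<close> along ray \<open>j\<close>
  stay feasible and change \<open>\<alpha> \<bullet> s\<close> by
  \<open>k * D * \<alpha> $ j\<close>. A negative coefficient would make
  \<open>\<alpha> \<bullet> s\<close> unbounded below, against validity.\<close>

lemma valid_ineq_corner_mip_nonneg:
  assumes R: "\<forall>i. R $ i $ j \<in> \<rat>"
    and ne: "corner_mip f R \<noteq> {}"
    and valid: "valid_ineq (convex hull (corner_mip f R)) \<alpha> \<beta>"
  shows "0 \<le> \<alpha> $ j"
proof (rule ccontr)
  assume neg: "\<not> 0 \<le> \<alpha> $ j"
  obtain x s where xs: "(x, s) \<in> corner_mip f R" using ne by auto
  obtain D :: nat where D: "0 < D" "\<And>i. real D * R $ i $ j \<in> \<int>"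
    using common_denominator_Rats[of UNIV "\<lambda>i. R $ i $ j"] R by auto
  have bound: "\<alpha> \<bullet> s + real k * (real D * \<alpha> $ j) \<ge> \<beta>" for k :: nat
  proof -
    have "(x + (real k * real D) *\<^sub>R column j R, s + (real k * real D) *\<^sub>R axis j 1)
        \<in> corner_mip f R"
      by (rule corner_mip_add_ray[OF xs]) (auto simp: mult.assoc D intro: Ints_mult)
    then have "(x + (real k * real D) *\<^sub>R column j R, s + (real k * real D) *\<^sub>R axis j 1)
        \<in> convex hull corner_mip f R"
      by (rule hull_inc)
    then have "\<alpha> \<bullet> (s + (real k * real D) *\<^sub>R axis j 1) \<ge> \<beta>"
      using valid unfolding valid_ineq_def by blast
    then show ?thesis by (simp add: inner_add_right inner_axis mult.assoc)
  qed
  \<comment> \<open>Each step lowers \<open>\<alpha> \<bullet> s\<close> by this fixed positive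
    amount, so some \<open>k\<close> uses up the whole slack
    \<open>\<alpha> \<bullet> s - \<beta>\<close>.\<close>
  have "0 < - (real D * \<alpha> $ j)" using D(1) neg by (simp add: mult_pos_neg)
  then obtain k :: nat where "\<alpha> \<bullet> s - \<beta> < real k * - (real D * \<alpha> $ j)"
    using reals_Archimedean3 by blast
  with bound[of k] show False by simp
qed

lemma norm_ray:
  "norm (column j R, axis j (1::real)) = sqrt ((\<Sum>i\<in>UNIV. (R $ i $ j)\<^sup>2) + 1)"
proof -
  have "(norm (column j R))\<^sup>2 = (\<Sum>i\<in>UNIV. (R $ i $ j)\<^sup>2)"
    by (simp add: norm_vec_def L2_set_def column_def sum_nonneg)
  then show ?thesis by (simp add: norm_Pair)
qed

lemma corner_lp_add_ray:
  assumes "(x, s) \<in> corner_lp f R" "0 \<le> t"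
  shows "(x, s) + t *\<^sub>R (column j R, axis j 1) \<in> corner_lp f R"
  using assms
  by (auto simp: corner_lp_def matrix_vector_right_distrib matrix_vector_mult_scaleR
      matrix_vector_mult_basis axis_one_nonneg)

text \<open>The affine hull contains the whole line through the two points \<open>z\<close> and
  \<open>z + ?d\<close> of the relaxation. Negative \<open>t\<close> matters: the depth bound walks
  backwards along the ray, where membership in the relaxation itself may fail.\<close>

lemma affine_hull_add_ray:
  assumes z: "z \<in> corner_lp f R"
  shows "z + t *\<^sub>R (column j R, axis j 1) \<in> affine hull (corner_lp f R)"
proof -
  let ?d = "(column j R, axis j (1::real))"
  have "z + ?d \<in> corner_lp f R"
    using z corner_lp_add_ray[of _ _ f R 1 j] by (cases z) simp
  then have "(1 - t) *\<^sub>R z + t *\<^sub>R (z + ?d) \<in> affine hull (corner_lp f R)"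
    using z by (intro mem_affine[OF affine_affine_hull]) (auto intro: hull_inc)
  then show ?thesis by (simp add: algebra_simps)
qed

lemma point_depth_corner_lp_le:
  assumes xs: "(x, s) \<in> corner_lp f R"
  shows "point_depth (corner_lp f R) (x, s)
    \<le> ennreal (s $ j * sqrt ((\<Sum>i\<in>UNIV. (R $ i $ j)\<^sup>2) + 1))"
  unfolding point_depth_def
proof (rule SUP_least)
  let ?d = "(column j R, axis j (1::real))"
  fix r assume "r \<in> {r. 0 \<le> r \<and> cball (x, s) r \<inter> affine hull corner_lp f R \<subseteq> corner_lp f R}"
  then have r: "0 \<le> r" "cball (x, s) r \<inter> affine hull corner_lp f R \<subseteq> corner_lp f R"
    by auto
  \<comment> \<open>With this scaling, \<open>- t *\<^sub>R ?d\<close> has length exactly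
    \<open>r\<close>, so the endpoint is on the boundary of the ball.\<close>
  define t where "t = r / norm ?d"
  have d: "norm ?d > 0" by (simp add: zero_prod_def)
  have "(x, s) + (- t) *\<^sub>R ?d \<in> cball (x, s) r"
    using d r(1) by (simp add: dist_norm t_def del: scaleR_Pair add_Pair)
  then have "(x, s) + (- t) *\<^sub>R ?d \<in> corner_lp f R"
    using affine_hull_add_ray[OF xs, of "- t" j] r(2) by blast
  \<comment> \<open>Coordinate \<open>j\<close> of \<open>s\<close> drops by exactly
    \<open>t\<close> along this walk, so its sign constraint caps \<open>t\<close>, and with it
    \<open>r\<close>.\<close>
  then have "0 \<le> (s + (- t) *\<^sub>R axis j 1) $ j"
    by (auto simp: corner_lp_def simp del: vector_minus_component)
  then have "t \<le> s $ j" by simp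
  then have "r \<le> s $ j * norm ?d"
    using d by (simp add: t_def pos_divide_le_eq)
  then show "ennreal r \<le> ennreal (s $ j * sqrt ((\<Sum>i\<in>UNIV. (R $ i $ j)\<^sup>2) + 1))"
    unfolding norm_ray by (rule ennreal_leI)
qed

theorem theorem4:
  fixes f :: "real^'m" and R :: "real^'n^'m" and \<alpha> :: "real^'n"
  assumes f_rational: "\<forall>i. f $ i \<in> \<rat>"
    and f_not_integral: "\<not> (\<forall>i. f $ i \<in> \<int>)"
    and R_rational: "\<forall>i j. R $ i $ j \<in> \<rat>"
    and nonempty: "corner_mip f R \<noteq> {}"
    and valid: "valid_ineq (convex hull (corner_mip f R)) \<alpha> 1"
  shows "ineq_depth (corner_lp f R) \<alpha> 1
    \<le> ennreal (Min {1 / \<alpha> $ j * sqrt ((\<Sum>i\<in>UNIV. (R $ i $ j)\<^sup>2) + 1) | j. \<alpha> $ j > 0})"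
proof -
  let ?M = "{1 / \<alpha> $ j * sqrt ((\<Sum>i\<in>UNIV. (R $ i $ j)\<^sup>2) + 1) | j. \<alpha> $ j > 0}"
  have nonneg: "0 \<le> \<alpha> $ j" for j
    using valid_ineq_corner_mip_nonneg[OF _ nonempty valid] R_rational by blast
  \<comment> \<open>A feasible point rules out \<open>\<alpha> = 0\<close>, since there
    \<open>\<alpha> \<bullet> s0 \<ge> 1\<close>. Some coefficient is therefore positive, and
    \<open>Min\<close> is attained on a nonempty finite set.\<close>
  obtain x0 s0 where xs0: "(x0, s0) \<in> corner_mip f R" using nonempty by auto
  have "\<alpha> \<bullet> s0 \<ge> 1"
    using valid hull_inc[OF xs0, of convex] unfolding valid_ineq_def by blast
  then have "\<alpha> \<noteq> 0" by auto
  then obtain j0 where "\<alpha> $ j0 \<noteq> 0" by (auto simp: vec_eq_iff)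
  then have "\<alpha> $ j0 > 0" using nonneg[of j0] by simp
  then have "?M \<noteq> {}" by blast
  moreover have "finite ?M" by simp
  ultimately have "Min ?M \<in> ?M" by (rule Min_in[rotated])
  then obtain j where j: "\<alpha> $ j > 0"
    and M: "Min ?M = 1 / \<alpha> $ j * sqrt ((\<Sum>i\<in>UNIV. (R $ i $ j)\<^sup>2) + 1)" by blast
  show ?thesis
    unfolding ineq_depth_def set_depth_def M
  proof (rule SUP_least)
    fix z assume "z \<in> corner_lp f R - {(x, s). (x, s) \<in> corner_lp f R \<and> 1 \<le> \<alpha> \<bullet> s}"
    then obtain x s where z: "z = (x, s)" and xs: "(x, s) \<in> corner_lp f R"
      and "\<not> 1 \<le> \<alpha> \<bullet> s"
      by (cases z) auto
    \<comment> \<open>Nonnegativity of \<open>\<alpha>\<close> and \<open>s\<close> makes every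
      summand nonnegative, so one term is at most the sum.\<close>
    have "\<alpha> $ j * s $ j \<le> (\<Sum>i\<in>UNIV. \<alpha> $ i * s $ i)"
      using xs nonneg by (intro member_le_sum) (auto simp: corner_lp_def)
    also have "\<dots> < 1" using \<open>\<not> 1 \<le> \<alpha> \<bullet> s\<close> by (simp add: inner_vec_def)
    finally have "s $ j \<le> 1 / \<alpha> $ j" using j by (simp add: field_simps)
    then have "s $ j * sqrt ((\<Sum>i\<in>UNIV. (R $ i $ j)\<^sup>2) + 1)
        \<le> 1 / \<alpha> $ j * sqrt ((\<Sum>i\<in>UNIV. (R $ i $ j)\<^sup>2) + 1)"
      by (intro mult_right_mono) (auto intro!: add_nonneg_nonneg sum_nonneg)
    then show "point_depth (corner_lp f R) z
        \<le> ennreal (1 / \<alpha> $ j * sqrt ((\<Sum>i\<in>UNIV. (R $ i $ j)\<^sup>2) + 1))"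
      using point_depth_corner_lp_le[OF xs, of j] unfolding z by (meson ennreal_leI order_trans)
  qed
qed

end
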